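(* Let $G$ be an abelian group and let $\varphi\in\mathrm{End}(G)$ be surjective. The following conditions are equivalent: (i) $s_0(\varphi)=0$; (ii) $s_0(\varphi)<\infty$; (iii) $\varphi$ is injective.
   Context: $\mathbb N=\{0,1,2,\dots\}$ and $\mathbb N_+=\mathbb N\setminus\{0\}$. For an endomorphism $\varphi$ of an abelian group $G$: a string of $\varphi$ is a sequence $S=\{x_n\}_{n\in\mathbb N}$ of pairwise distinct elements of $G$ with $\varphi(x_n)=x_{n-1}$ for every $n\in\mathbb N_+$. A null string is a string with $x_0\neq 0$ and $\varphi^k(x_0)=0$ for some $k\in\mathbb N_+$. The null string number is $s_0(\varphi)=\sup\{|\mathcal F|:\mathcal F$ is a family of pairwise disjoint null strings of $\varphi$ in $G\}$ (disjointness refers to the underlying sets of elements); it takes values in $\mathbb N\cup\{\infty\}$, i.e. it is set equal to $\infty$ whenever the supremum is infinite. *)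

theory Defs
  imports
    "HOL-Algebra.Group"
    "HOL-Library.Disjoint_Sets"
    "HOL-Library.Extended_Nat"
begin

text \<open>Abelian groups are HOL-Algebra's multiplicatively written \<^locale>\<open>comm_group\<close>s, so the
  neutral element \<open>0\<close> of the additive convention appears as \<open>\<one>\<close>.\<close>

definition is_string :: "('a, 'b) monoid_scheme \<Rightarrow> ('a \<Rightarrow> 'a) \<Rightarrow> (nat \<Rightarrow> 'a) \<Rightarrow> bool" where
  "is_string G \<phi> x \<longleftrightarrow>
     range x \<subseteq> carrier G \<and> inj x \<and> (\<forall>n>0. \<phi> (x n) = x (n - 1))"

definition null_string :: "('a, 'b) monoid_scheme \<Rightarrow> ('a \<Rightarrow> 'a) \<Rightarrow> (nat \<Rightarrow> 'a) \<Rightarrow> bool" where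
  "null_string G \<phi> x \<longleftrightarrow>
     is_string G \<phi> x \<and> x 0 \<noteq> \<one>\<^bsub>G\<^esub> \<and> (\<exists>k>0. (\<phi> ^^ k) (x 0) = \<one>\<^bsub>G\<^esub>)"

text \<open>Unlike \<^const>\<open>card\<close>, infinite sets get size \<open>\<infinity>\<close> here instead of \<open>0\<close>.\<close>

definition ecard :: "'a set \<Rightarrow> enat" where
  "ecard A = (if finite A then enat (card A) else \<infinity>)"

text \<open>Families need not be indexed: null strings are nonempty, so no member of a pairwise
  disjoint family can be repeated.\<close>

definition null_string_number :: "('a, 'b) monoid_scheme \<Rightarrow> ('a \<Rightarrow> 'a) \<Rightarrow> enat" where
  "null_string_number G \<phi> =
     Sup {ecard F | F. (\<forall>x\<in>F. null_string G \<phi> x) \<and> disjoint_family_on range F}"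

end

theory Submission
  imports Defs "HOL-Algebra.Coset"
begin

text \<open>
  If \<open>\<phi>\<close> is injective, so are its iterates, none of which can then kill a nontrivial element; there
  are no null strings at all.  Conversely, suppose that \<open>\<phi>\<close> is surjective with a nontrivial kernel
  element \<open>a\<close>.  Surjectivity produces a backward orbit \<open>x\<close> with \<open>x 0 = a\<close>, and this one sequence
  already yields infinitely many disjoint null strings \<open>y m n = x n \<otimes> x (n + m)\<close>, one for each
  \<open>m > 0\<close> (lemma \<open>twisted_strings\<close>).  Everything is decided by the level of an element, the largest \<open>k\<close>
  with \<open>\<phi>\<^sup>k\<close> not killing it: \<open>x n\<close> has level \<open>n\<close>, hence \<open>y m n\<close> has level \<open>n + m\<close>.
  So \<open>y m n\<close> determines \<open>n + m\<close>, therefore \<open>x (n + m)\<close>, therefore by cancellation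
  \<open>x n\<close>, whose level is \<open>n\<close>; that is, \<open>(m, n)\<close> is determined.  Thus every \<open>y m\<close> is injective
  and distinct \<open>y m\<close> are disjoint, which makes the null string number infinite.
\<close>

lemma funpow_hom:
  assumes "\<phi> \<in> hom G G"
  shows "(\<phi> ^^ k) \<in> hom G G"
proof (induction k)
  case (Suc k)
  then show ?case using assms by (auto simp: hom_def Pi_iff)
qed (auto simp: hom_def)

lemma level_unique:
  fixes i j :: nat
  assumes "(\<phi> ^^ i) u \<noteq> e" "\<And>k. k > i \<Longrightarrow> (\<phi> ^^ k) u = e"
    and "(\<phi> ^^ j) u \<noteq> e" "\<And>k. k > j \<Longrightarrow> (\<phi> ^^ k) u = e"
  shows "i = j"
  using assms by (meson linorder_neqE_nat)

lemma backward_orbit_exists: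
  assumes surj: "\<phi> ` A = A" and a: "a \<in> A"
  obtains x where "x 0 = a" "\<And>n. x n \<in> A" "\<And>n. \<phi> (x (Suc n)) = x n"
proof -
  define x where "x = rec_nat a (\<lambda>_. inv_into A \<phi>)"
  have step: "x (Suc n) = inv_into A \<phi> (x n)" for n
    by (simp add: x_def)
  have mem: "x n \<in> A" for n
  proof (induction n)
    case 0
    then show ?case using a by (simp add: x_def)
  next
    case (Suc n)
    then show ?case unfolding step by (metis inv_into_into surj)
  qed
  have "\<phi> (x (Suc n)) = x n" for n
    unfolding step by (rule f_inv_into_f) (simp add: surj mem)
  with mem show thesis by (intro that[of x]) (simp_all add: x_def)
qed

lemma no_null_string_if_inj:
  assumes "group G" "\<phi> \<in> hom G G" "inj_on \<phi> (carrier G)"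
  shows "\<not> null_string G \<phi> x"
proof
  assume "null_string G \<phi> x"
  then obtain k where x0: "x 0 \<in> carrier G" "x 0 \<noteq> \<one>\<^bsub>G\<^esub>" and k: "(\<phi> ^^ k) (x 0) = \<one>\<^bsub>G\<^esub>"
    by (auto simp: null_string_def is_string_def)
  interpret group_hom G G \<phi>
    using assms(1,2) by (simp add: group_hom_def group_hom_axioms_def)
  have "u = \<one>\<^bsub>G\<^esub>" if "u \<in> carrier G" "(\<phi> ^^ k) u = \<one>\<^bsub>G\<^esub>" for u
    using that
  proof (induction k arbitrary: u)
    case (Suc k)
    then have "\<phi> u = \<one>\<^bsub>G\<^esub>"
      by (simp add: funpow_swap1)
    then show ?case
      using assms(3) Suc.prems(1) by (metis hom_one inj_onD G.one_closed)
  qed simp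
  with x0 k show False by blast
qed

text \<open>
  The shift \<open>m\<close> must be positive: then the factor \<open>x n\<close> dies strictly before \<open>x (n + m)\<close> and cannot
  interfere with the level of the product, whereas for \<open>m = 0\<close> the product is the square of \<open>x n\<close>,
  which is trivial in a group of exponent two.
\<close>

lemma twisted_strings:
  fixes G (structure)
  assumes "group G" and hom: "\<phi> \<in> hom G G"
    and mem: "\<And>n. x n \<in> carrier G" and step: "\<And>n. \<phi> (x (Suc n)) = x n"
    and x0: "x 0 \<noteq> \<one>" and ker: "\<phi> (x 0) = \<one>"
  defines "y \<equiv> \<lambda>m n. x n \<otimes> x (n + m)"
  shows "\<And>m. m > 0 \<Longrightarrow> null_string G \<phi> (y m)"
    and "\<And>m m' n n'. \<lbrakk>m > 0; m' > 0; y m n = y m' n'\<rbrakk> \<Longrightarrow> m = m' \<and> n = n'"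
proof -
  interpret group G by fact
  interpret pow: group_hom G G "\<phi> ^^ k" for k
    by unfold_locales (rule funpow_hom[OF hom])
  have below: "(\<phi> ^^ k) (x (k + n)) = x n" for k n
    by (induction k) (simp_all add: step funpow_swap1)
  have above: "(\<phi> ^^ k) (x n) = \<one>" if "k > n" for k n
  proof -
    from that obtain d where d: "k = d + Suc n"
      by (metis add.commute less_natE add_Suc_right)
    have "(\<phi> ^^ Suc n) (x n) = \<one>"
      using below[of n 0] ker by simp
    then show ?thesis
      unfolding d funpow_add comp_apply by simp
  qed
  have x_level: "(\<phi> ^^ n) (x n) \<noteq> \<one>" for n
    using below[of n 0] x0 by simp
  have x_inj: "n = n'" if "x n = x n'" for n n'
    by (rule level_unique[where \<phi> = \<phi> and u = "x n" and e = \<one>]) (use that x_level above in metis)+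
  have y_mem: "y m n \<in> carrier G" for m n
    by (simp add: y_def mem)
  have y_level: "(\<phi> ^^ (n + m)) (y m n) = x 0" if "m > 0" for m n
    using that below[of "n + m" 0] above[of n "n + m"] by (simp add: y_def mem)
  have y_above: "(\<phi> ^^ k) (y m n) = \<one>" if "k > n + m" for k m n
    using that above[of n k] above[of "n + m" k] by (simp add: y_def mem)
  show determined: "m = m' \<and> n = n'" if "m > 0" "m' > 0" and eq: "y m n = y m' n'" for m m' n n'
  proof -
    have sum: "n + m = n' + m'"
      by (rule level_unique[where \<phi> = \<phi> and u = "y m n" and e = \<one>])
        (use that y_level y_above x0 in metis)+
    with eq have "x n = x n'"
      by (simp add: y_def mem)
    then have "n = n'" by (rule x_inj)
    with sum show ?thesis by simp
  qed
  show "null_string G \<phi> (y m)" if m: "m > 0" for m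
  proof -
    have "inj (y m)"
      using determined[OF m m] by (auto intro: injI)
    moreover have "\<phi> (y m n) = y m (n - 1)" if "n > 0" for n
    proof -
      from that obtain n' where "n = Suc n'" by (cases n) auto
      then show ?thesis by (simp add: y_def hom_mult[OF hom] mem step)
    qed
    ultimately have "is_string G \<phi> (y m)"
      using y_mem by (auto simp: is_string_def)
    moreover have "y m 0 \<noteq> \<one>"
      using y_level[OF m, of 0] x0 by auto
    moreover have "(\<phi> ^^ Suc m) (y m 0) = \<one>"
      by (rule y_above) simp
    ultimately show ?thesis
      unfolding null_string_def by blast
  qed
qed

lemma null_string_number_eq_0:
  fixes G :: "('a, 'b) monoid_scheme"
  assumes "\<And>x. \<not> null_string G \<phi> x"
  shows "null_string_number G \<phi> = 0"
proof -
  have "{ecard F | F. (\<forall>x\<in>F. null_string G \<phi> x) \<and> disjoint_family_on range F} = {ecard ({} :: (nat \<Rightarrow> 'a) set)}"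
    using assms by (auto simp: disjoint_family_on_def)
  then show ?thesis
    by (simp add: null_string_number_def ecard_def zero_enat_def)
qed

lemma null_string_number_eq_infinity:
  assumes "infinite F" "\<And>x. x \<in> F \<Longrightarrow> null_string G \<phi> x" "disjoint_family_on range F"
  shows "null_string_number G \<phi> = \<infinity>"
proof -
  have "ecard F \<le> null_string_number G \<phi>"
    unfolding null_string_number_def by (rule Sup_upper) (use assms in blast)
  then show ?thesis
    using assms(1) by (simp add: ecard_def)
qed

lemma null_string_number_not_inj:
  fixes G (structure)
  assumes "group G" and hom: "\<phi> \<in> hom G G" and surj: "\<phi> ` carrier G = carrier G"
    and "\<not> inj_on \<phi> (carrier G)"
  shows "null_string_number G \<phi> = \<infinity>"
proof -
  interpret group_hom G G \<phi>
    using assms(1) hom by (simp add: group_hom_def group_hom_axioms_def)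
  obtain a where a: "a \<in> carrier G" "\<phi> a = \<one>" "a \<noteq> \<one>"
    using assms(4) inj_iff_trivial_ker by (auto simp: kernel_def)
  obtain x where x: "x 0 = a" "\<And>n. x n \<in> carrier G" "\<And>n. \<phi> (x (Suc n)) = x n"
    using backward_orbit_exists[OF surj a(1)] by blast
  have x0: "x 0 \<noteq> \<one>" and ker: "\<phi> (x 0) = \<one>"
    by (simp_all add: x(1) a)
  define y where "y = (\<lambda>m n. x n \<otimes> x (n + m))"
  have null: "null_string G \<phi> (y m)" if "m > 0" for m
    unfolding y_def
    by (rule twisted_strings(1)[OF assms(1) hom x(2,3) x0 ker that])
  have determined: "m = m' \<and> n = n'" if "m > 0" "m' > 0" "y m n = y m' n'" for m m' n n'
    by (rule twisted_strings(2)[OF assms(1) hom x(2,3) x0 ker that[unfolded y_def]])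
  have "inj_on y {0<..}"
    using determined by (metis inj_onI greaterThan_iff)
  then have "infinite (y ` {0<..})"
    by (simp add: finite_image_iff infinite_Ioi)
  moreover have "disjoint_family_on range (y ` {0<..})"
    unfolding disjoint_family_on_def using determined by blast
  ultimately show ?thesis
    using null by (intro null_string_number_eq_infinity) auto
qed

theorem mainTheorem6:
  fixes G :: "('a, 'b) monoid_scheme" and \<phi> :: "'a \<Rightarrow> 'a"
  assumes "comm_group G"
    and "\<phi> \<in> hom G G"
    and "\<phi> ` carrier G = carrier G"
  shows "(null_string_number G \<phi> = 0 \<longleftrightarrow> null_string_number G \<phi> < \<infinity>)
       \<and> (null_string_number G \<phi> < \<infinity> \<longleftrightarrow> inj_on \<phi> (carrier G))"
proof -
  have G: "group G"
    using assms(1) by (rule comm_group.axioms(2))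
  show ?thesis
  proof (cases "inj_on \<phi> (carrier G)")
    case True
    then have "null_string_number G \<phi> = 0"
      using no_null_string_if_inj[OF G assms(2)] by (blast intro: null_string_number_eq_0)
    with True show ?thesis by simp
  next
    case False
    then show ?thesis
      using null_string_number_not_inj[OF G assms(2,3)] by simp
  qed
qed

end
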